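(* Let $n\ge1$, $0<p<1$ and let $k$ be even with $k\le n$. Then $$M(n,k,p)\le\frac{p^n}{\mathbb{P}\left(\mathrm{Bin}(n,1-p)\le\frac k2\right)}.$$
   Context: $\mathcal{A}(n,k,p)$ is the set of all probability distributions $\mathbb{Q}$ of $n$ bits $(X_1,\ldots,X_n)\in\{0,1\}^n$ that are $k$-wise independent (every subset of at most $k$ of the bits is independent) and satisfy $\mathbb{Q}(X_i=1)=p$ for all $i$. $M(n,k,p):=\max_{\mathbb{Q}\in\mathcal{A}(n,k,p)}\mathbb{Q}(\text{all bits are }1)$. $\mathrm{Bin}(n,q)$ denotes a binomial random variable with $n$ trials and success probability $q$. *)

theory Defs
  imports "HOL-Probability.Probability"
begin

text \<open>A configuration of \<open>n\<close> bits is a function in \<open>{1..n} \<rightarrow>\<^sub>E UNIV\<close>; \<open>x i\<close> means \<open>X\<^sub>i = 1\<close>.\<close>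

definition bits :: "nat \<Rightarrow> (nat \<Rightarrow> bool) set" where
  "bits n = {1..n} \<rightarrow>\<^sub>E UNIV"

definition kwise_indep :: "nat \<Rightarrow> nat \<Rightarrow> (nat \<Rightarrow> bool) pmf \<Rightarrow> bool" where
  "kwise_indep n k Q \<longleftrightarrow>
     (\<forall>J \<subseteq> {1..n}. card J \<le> k \<longrightarrow>
        prob_space.indep_vars (measure_pmf Q) (\<lambda>_. count_space UNIV) (\<lambda>i x. x i) J)"

definition kwise_dists :: "nat \<Rightarrow> nat \<Rightarrow> real \<Rightarrow> (nat \<Rightarrow> bool) pmf set" where
  "kwise_dists n k p =
     {Q. set_pmf Q \<subseteq> bits n \<and> kwise_indep n k Q \<and>
         (\<forall>i\<in>{1..n}. measure_pmf.prob Q {x. x i} = p)}"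

text \<open>\<open>GREATEST\<close> rather than \<open>Max\<close>, because the set of attained values is infinite in general.
  Lemma \<open>max_all_ones_attained\<close> below shows that the maximum exists.\<close>

definition max_all_ones :: "nat \<Rightarrow> nat \<Rightarrow> real \<Rightarrow> real" where
  "max_all_ones n k p =
     (GREATEST m. m \<in> (\<lambda>Q. measure_pmf.prob Q {x. \<forall>i\<in>{1..n}. x i}) ` kwise_dists n k p)"

lemma finite_bits: "finite (bits n)"
  unfolding bits_def by (intro finite_PiE) auto

lemma prob_eq_sum_bits:
  assumes "set_pmf Q \<subseteq> bits n"
  shows "measure_pmf.prob Q E = (\<Sum>x\<in>bits n \<inter> E. pmf Q x)"
proof -
  have "measure_pmf.prob Q E = measure_pmf.prob Q (bits n \<inter> E)"
    using assms by (intro measure_pmf.finite_measure_eq_AE) (auto simp: AE_measure_pmf_iff)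
  also have "\<dots> = (\<Sum>x\<in>bits n \<inter> E. pmf Q x)"
    using finite_bits by (intro measure_measure_pmf_finite) auto
  finally show ?thesis .
qed

lemma kwise_indep_iff:
  "kwise_indep n k Q \<longleftrightarrow>
     (\<forall>J \<subseteq> {1..n}. card J \<le> k \<longrightarrow> J \<noteq> {} \<longrightarrow>
        (\<forall>A. measure_pmf.prob Q (\<Inter>j\<in>J. {x. x j \<in> A j}) =
             (\<Prod>j\<in>J. measure_pmf.prob Q {x. x j \<in> A j})))"
    (is "_ \<longleftrightarrow> ?R")
proof
  assume L: "kwise_indep n k Q"
  show ?R
  proof (intro allI impI)
    fix J and A :: "nat \<Rightarrow> bool set"
    assume J: "J \<subseteq> {1..n}" "card J \<le> k" "J \<noteq> {}"
    then have "finite J" using finite_subset by blast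
    have "prob_space.indep_sets (measure_pmf Q) (\<lambda>i. {(\<lambda>x. x i) -` A \<inter> space (measure_pmf Q) |A. A \<in> sets (count_space UNIV)}) J"
      using L J unfolding kwise_indep_def prob_space.indep_vars_def2[OF prob_space_measure_pmf] by blast
    from prob_space.indep_setsD[OF prob_space_measure_pmf this, of J "\<lambda>j. {x. x j \<in> A j}"] \<open>finite J\<close> J
    show "measure_pmf.prob Q (\<Inter>j\<in>J. {x. x j \<in> A j}) =
             (\<Prod>j\<in>J. measure_pmf.prob Q {x. x j \<in> A j})"
      by (auto simp: vimage_def)
  qed
next
  assume R: ?R
  show "kwise_indep n k Q"
    unfolding kwise_indep_def prob_space.indep_vars_def2[OF prob_space_measure_pmf]
  proof (intro allI impI conjI ballI prob_space.indep_setsI[OF prob_space_measure_pmf])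
    fix J A J'
    assume J: "J \<subseteq> {1..n}" "card J \<le> k" and J': "J' \<noteq> {}" "J' \<subseteq> J" "finite J'"
      and A: "\<forall>j\<in>J'. A j \<in> {(\<lambda>x. x j) -` A \<inter> space (measure_pmf Q) |A. A \<in> sets (count_space UNIV)}"
    from A obtain B where B: "\<And>j. j \<in> J' \<Longrightarrow> A j = {x. x j \<in> B j}"
      by (simp add: vimage_def) metis
    have "finite J" using J(1) finite_subset by blast
    then have "card J' \<le> k" using J J' card_mono by (meson order_trans)
    then have "measure_pmf.prob Q (\<Inter>j\<in>J'. {x. x j \<in> B j}) =
             (\<Prod>j\<in>J'. measure_pmf.prob Q {x. x j \<in> B j})"
      using R J J' by (meson order_trans)
    then show "measure_pmf.prob Q (\<Inter> (A ` J')) = (\<Prod>j\<in>J'. measure_pmf.prob Q (A j))"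
      using B by (simp cong: INF_cong prod.cong)
  qed (simp_all add: subset_iff)
qed

lemma kwise_dists_nonempty:
  assumes "0 \<le> p" "p \<le> 1"
  shows "kwise_dists n k p \<noteq> {}"
proof -
  define Q where "Q = Pi_pmf {1..n} undefined (\<lambda>_. bernoulli_pmf p)"
  have "set_pmf Q \<subseteq> bits n"
    using set_Pi_pmf_subset[of "{1..n}" undefined "\<lambda>_. bernoulli_pmf p"]
    by (auto simp: Q_def bits_def PiE_def extensional_def)
  moreover have "kwise_indep n k Q"
    unfolding kwise_indep_def Q_def
    by (intro allI impI prob_space.indep_vars_subset[OF prob_space_measure_pmf
          indep_vars_Pi_pmf[OF finite_atLeastAtMost]])
  moreover have "measure_pmf.prob Q {x. x i} = p" if "i \<in> {1..n}" for i
  proof -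
    have "measure_pmf.prob Q {x. x i} = measure_pmf.prob (map_pmf (\<lambda>f. f i) Q) {True}"
      by (simp add: vimage_def)
    also have "\<dots> = p"
      using that assms by (simp add: Q_def Pi_pmf_component measure_pmf_single)
    finally show ?thesis .
  qed
  ultimately show ?thesis by (auto simp: kwise_dists_def)
qed

lemma kwise_dists_compact_image:
  "compact ((\<lambda>Q. measure_pmf.prob Q {x. \<forall>i\<in>{1..n}. x i}) ` kwise_dists n k p)"
proof -
  define pr :: "((nat \<Rightarrow> bool) \<Rightarrow> real) \<Rightarrow> (nat \<Rightarrow> bool) set \<Rightarrow> real"
    where "pr = (\<lambda>f E. \<Sum>x\<in>bits n \<inter> E. f x)"
  define K :: "((nat \<Rightarrow> bool) \<Rightarrow> real) set"
    where "K = (\<Pi>\<^sub>E x\<in>UNIV. if x \<in> bits n then {0..1} else {0})"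
  define C where "C = {f. pr f UNIV = 1} \<inter> (\<Inter>i\<in>{1..n}. {f. pr f {x. x i} = p}) \<inter>
     (\<Inter>J\<in>{J. J \<subseteq> {1..n} \<and> card J \<le> k \<and> J \<noteq> {}}. \<Inter>A.
        {f. pr f (\<Inter>j\<in>J. {x. x j \<in> A j}) = (\<Prod>j\<in>J. pr f {x. x j \<in> A j})})"
  have cont: "continuous_on UNIV (\<lambda>f. pr f E)" for E
    unfolding pr_def by (intro continuous_on_sum continuous_on_product_coordinates)
  have "compactin (product_topology (\<lambda>_. euclidean) UNIV) K"
    unfolding K_def by (subst compactin_PiE) (auto simp: compactin_euclidean_iff)
  then have "compact K"
    by (simp add: euclidean_product_topology compactin_euclidean_iff)
  moreover have "closed C"
    unfolding C_def
    by (intro closed_Int closed_INT ballI closed_Collect_eq cont continuous_on_const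
        continuous_on_prod)
  ultimately have "compact (K \<inter> C)" by blast
  then have "compact ((\<lambda>f. pr f {x. \<forall>i\<in>{1..n}. x i}) ` (K \<inter> C))"
    by (intro compact_continuous_image continuous_on_subset[OF cont]) auto
  also have "(\<lambda>f. pr f {x. \<forall>i\<in>{1..n}. x i}) ` (K \<inter> C) =
     (\<lambda>f. pr f {x. \<forall>i\<in>{1..n}. x i}) ` pmf ` kwise_dists n k p"
  proof (rule arg_cong[where f = "image _"], intro equalityI subsetI)
    fix f assume f: "f \<in> K \<inter> C"
    then have out: "f x = 0" if "x \<notin> bits n" for x
      using that by (auto simp: K_def PiE_iff split: if_splits)
    have nonneg: "f x \<ge> 0" for x
      using f by (cases "x \<in> bits n") (auto simp: K_def PiE_iff split: if_splits)
    have "(\<integral>\<^sup>+x. ennreal (f x) \<partial>count_space UNIV) = (\<Sum>x\<in>bits n. ennreal (f x))"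
      using finite_bits out by (intro nn_integral_count_space') auto
    also have "\<dots> = ennreal (\<Sum>x\<in>bits n. f x)"
      using nonneg by simp
    also have "\<dots> = 1"
      using f by (simp add: C_def pr_def)
    finally have int: "(\<integral>\<^sup>+x. ennreal (f x) \<partial>count_space UNIV) = 1" .
    define Q where "Q = embed_pmf f"
    have Q: "pmf Q = f"
      unfolding Q_def using pmf_embed_pmf[OF nonneg int] by auto
    have sub: "set_pmf Q \<subseteq> bits n"
      using out by (auto simp: set_pmf_eq Q)
    have "measure_pmf.prob Q E = pr f E" for E
      by (simp add: prob_eq_sum_bits[OF sub] pr_def Q)
    then have "Q \<in> kwise_dists n k p"
      using f sub by (auto simp: kwise_dists_def kwise_indep_iff C_def)
    then show "f \<in> pmf ` kwise_dists n k p" using Q by blast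
  next
    fix f assume "f \<in> pmf ` kwise_dists n k p"
    then obtain Q where Q: "Q \<in> kwise_dists n k p" "f = pmf Q" by blast
    then have sub: "set_pmf Q \<subseteq> bits n" by (simp add: kwise_dists_def)
    have pr: "pr f E = measure_pmf.prob Q E" for E
      by (simp add: prob_eq_sum_bits[OF sub] pr_def Q)
    have "f \<in> C"
      using Q(1) measure_pmf.prob_space[of Q]
      by (simp add: C_def pr kwise_dists_def kwise_indep_iff)
    moreover have "f \<in> K"
      using sub by (auto simp: K_def Q(2) pmf_le_1 set_pmf_eq)
    ultimately show "f \<in> K \<inter> C" by blast
  qed
  also have "\<dots> = (\<lambda>Q. measure_pmf.prob Q {x. \<forall>i\<in>{1..n}. x i}) ` kwise_dists n k p"
    unfolding image_image pr_def
    by (intro image_cong refl prob_eq_sum_bits[symmetric]) (auto simp: kwise_dists_def)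
  finally show ?thesis .
qed

lemma max_all_ones_attained:
  assumes "0 \<le> p" "p \<le> 1"
  shows "\<exists>Q\<in>kwise_dists n k p. max_all_ones n k p = measure_pmf.prob Q {x. \<forall>i\<in>{1..n}. x i}"
    and "\<And>Q. Q \<in> kwise_dists n k p \<Longrightarrow>
           measure_pmf.prob Q {x. \<forall>i\<in>{1..n}. x i} \<le> max_all_ones n k p"
proof -
  let ?S = "(\<lambda>Q. measure_pmf.prob Q {x. \<forall>i\<in>{1..n}. x i}) ` kwise_dists n k p"
  have "?S \<noteq> {}"
    using kwise_dists_nonempty[OF assms] by (simp only: image_is_empty not_False_eq_True)
  from compact_attains_sup[OF kwise_dists_compact_image this]
  obtain m where m: "m \<in> ?S" "\<forall>t\<in>?S. t \<le> m" by (elim bexE)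
  have eq: "max_all_ones n k p = m"
    unfolding max_all_ones_def using m by (intro Greatest_equality) blast+
  show "\<exists>Q\<in>kwise_dists n k p. max_all_ones n k p = measure_pmf.prob Q {x. \<forall>i\<in>{1..n}. x i}"
    using m(1) eq by auto
  show "\<And>Q. Q \<in> kwise_dists n k p \<Longrightarrow>
           measure_pmf.prob Q {x. \<forall>i\<in>{1..n}. x i} \<le> max_all_ones n k p"
    using m(2) eq by auto
qed

end

theory Submission
  imports Defs
begin

text \<open>
  Put \<open>q = 1 - p\<close> and \<open>m = k / 2\<close>. The products \<open>\<chi>\<^sub>A = \<Prod>\<^sub>i\<^sub>\<in>\<^sub>A (X\<^sub>i - p) / p\<close> with \<open>|A| \<le> m\<close> have pairwise
  correlations that involve at most \<open>k\<close> bits, so under every \<open>k\<close>-wise independent law they are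
  orthogonal with \<open>E \<chi>\<^sub>A\<^sup>2 = (q/p)\<^bsup>|A|\<^esup>\<close>; this number is also the value of \<open>\<chi>\<^sub>A\<close> at the all-ones
  configuration. Hence \<open>G = \<Sum>\<^sub>A \<chi>\<^sub>A\<close> satisfies \<open>E G\<^sup>2 = G(1,\<dots>,1) = D\<close> with
  \<open>D = \<Sum>\<^sub>j\<^sub>\<le>\<^sub>m (n choose j) (q/p)\<^sup>j\<close>, and Markov's inequality for \<open>G\<^sup>2\<close> bounds the probability of
  all ones by \<open>D / D\<^sup>2 = 1 / D\<close>.
\<close>

text \<open>Dividing by \<open>p\<close> rather than by the standard deviation makes the value at
  \<open>True\<close> equal to the second moment of a bit with bias \<open>p\<close>: both are
  \<open>(1 - p) / p\<close>.\<close>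

definition centered_bit :: "real \<Rightarrow> bool \<Rightarrow> real" where
  "centered_bit p b = (of_bool b - p) / p"

definition bit_character :: "real \<Rightarrow> nat set \<Rightarrow> (nat \<Rightarrow> bool) \<Rightarrow> real" where
  "bit_character p A x = (\<Prod>i\<in>A. centered_bit p (x i))"

lemma integrable_kwise_dists:
  fixes f :: "(nat \<Rightarrow> bool) \<Rightarrow> real"
  assumes "Q \<in> kwise_dists n k p"
  shows "integrable (measure_pmf Q) f"
proof (rule integrable_measure_pmf_finite)
  show "finite (set_pmf Q)"
    using assms finite_bits finite_subset unfolding kwise_dists_def by blast
qed

lemma expectation_single_bit:
  fixes f :: "bool \<Rightarrow> real"
  assumes Q: "Q \<in> kwise_dists n k p" and i: "i \<in> {1..n}"
  shows "measure_pmf.expectation Q (\<lambda>x. f (x i)) = p * f True + (1 - p) * f False"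
proof -
  have P: "measure_pmf.prob Q {x. x i} = p"
    using Q i by (simp add: kwise_dists_def)
  \<comment> \<open>Every function of one bit is affine in its indicator, so linearity
    suffices.\<close>
  have "f (x i) = f False + (f True - f False) * indicator {x. x i} x" for x
    by (cases "x i") auto
  then have "measure_pmf.expectation Q (\<lambda>x. f (x i)) =
      measure_pmf.expectation Q (\<lambda>x. f False + (f True - f False) * indicator {x. x i} x)"
    by presburger
  also have "\<dots> = f False + (f True - f False) * p"
    by (simp add: P integrable_kwise_dists[OF Q])
  finally show ?thesis by (simp add: algebra_simps)
qed

text \<open>Independence of the bits in \<open>J\<close> factors the expectation. Letting
  \<open>f i\<close> vary with \<open>i\<close> allows a product of two characters to be read as one
  product over the union of their index sets.\<close>

lemma expectation_prod_bits:
  fixes f :: "nat \<Rightarrow> bool \<Rightarrow> real"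
  assumes Q: "Q \<in> kwise_dists n k p" and J: "J \<subseteq> {1..n}" "card J \<le> k"
  shows "measure_pmf.expectation Q (\<lambda>x. \<Prod>i\<in>J. f i (x i)) =
    (\<Prod>i\<in>J. p * f i True + (1 - p) * f i False)"
proof -
  have fin: "finite J" using J(1) finite_subset by blast
  have "prob_space.indep_vars (measure_pmf Q) (\<lambda>_. count_space UNIV) (\<lambda>i x. x i) J"
    using Q J unfolding kwise_dists_def kwise_indep_def by blast
  then have "prob_space.indep_vars (measure_pmf Q) (\<lambda>_. borel) (\<lambda>i x. f i (x i)) J"
    by (rule prob_space.indep_vars_compose2[OF prob_space_measure_pmf]) simp
  from prob_space.indep_vars_lebesgue_integral[OF prob_space_measure_pmf fin this]
  have "measure_pmf.expectation Q (\<lambda>x. \<Prod>i\<in>J. f i (x i)) =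
      (\<Prod>i\<in>J. measure_pmf.expectation Q (\<lambda>x. f i (x i)))"
    by (simp add: integrable_kwise_dists[OF Q])
  also have "\<dots> = (\<Prod>i\<in>J. p * f i True + (1 - p) * f i False)"
    using J(1) by (intro prod.cong refl expectation_single_bit[OF Q]) auto
  finally show ?thesis .
qed

lemma bit_character_orthogonal:
  assumes p: "p \<noteq> 0" and Q: "Q \<in> kwise_dists n k p"
    and A: "A \<subseteq> {1..n}" and B: "B \<subseteq> {1..n}" and card: "card A + card B \<le> k"
  shows "measure_pmf.expectation Q (\<lambda>x. bit_character p A x * bit_character p B x) =
    (if A = B then ((1 - p) / p) ^ card A else 0)"
proof -
  \<comment> \<open>\<open>f i\<close> is the centered bit raised to the number of sets among
    \<open>A\<close>, \<open>B\<close> that contain \<open>i\<close>.\<close>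
  define f where "f i b = (if i \<in> A then centered_bit p b else 1) *
    (if i \<in> B then centered_bit p b else 1)" for i b
  have fin: "finite A" "finite B" using A B finite_subset by blast+
  have split: "bit_character p A x * bit_character p B x = (\<Prod>i\<in>A \<union> B. f i (x i))" for x
  proof -
    have "(\<Prod>i\<in>A \<union> B. if i \<in> A then centered_bit p (x i) else 1) = bit_character p A x"
      "(\<Prod>i\<in>A \<union> B. if i \<in> B then centered_bit p (x i) else 1) = bit_character p B x"
      unfolding bit_character_def using fin
      by (simp_all add: Int_absorb1 flip: prod.inter_restrict)
    then show ?thesis by (simp add: f_def prod.distrib)
  qed
  have "card (A \<union> B) \<le> k" using card_Un_le[of A B] card by linarith
  then have E: "measure_pmf.expectation Q (\<lambda>x. bit_character p A x * bit_character p B x) =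
      (\<Prod>i\<in>A \<union> B. p * f i True + (1 - p) * f i False)"
    unfolding split using A B by (intro expectation_prod_bits[OF Q]) auto
  show ?thesis
  proof (cases "A = B")
    case True
    have "p * f i True + (1 - p) * f i False = (1 - p) / p" if "i \<in> A" for i
      using p that True by (simp add: f_def centered_bit_def field_simps)
    then show ?thesis unfolding E using True by simp
  next
    case False
    \<comment> \<open>A bit in exactly one of the two sets contributes the mean of a centered bit,
      which is zero and annihilates the product.\<close>
    then obtain i where "i \<in> A \<union> B" "i \<notin> A \<inter> B" by blast
    then have "p * f i True + (1 - p) * f i False = 0"
      using p by (auto simp: f_def centered_bit_def field_simps)
    then show ?thesis
      using False fin \<open>i \<in> A \<union> B\<close> by (auto simp: E intro!: prod_zero)
  qed
qed

lemma sum_power_card_small_subsets: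
  fixes r :: "'b :: comm_semiring_1"
  assumes "finite S"
  shows "(\<Sum>A\<in>{A. A \<subseteq> S \<and> card A \<le> m}. r ^ card A) = (\<Sum>j\<le>m. of_nat (card S choose j) * r ^ j)"
proof -
  have "(\<Sum>A\<in>{A. A \<subseteq> S \<and> card A \<le> m}. r ^ card A) =
      (\<Sum>j\<le>m. \<Sum>A\<in>{A \<in> {A. A \<subseteq> S \<and> card A \<le> m}. card A = j}. r ^ card A)"
    using assms by (intro sum.group[symmetric]) auto
  also have "\<dots> = (\<Sum>j\<le>m. \<Sum>A\<in>{A. A \<subseteq> S \<and> card A = j}. r ^ j)"
    by (intro sum.cong) auto
  also have "\<dots> = (\<Sum>j\<le>m. of_nat (card S choose j) * r ^ j)"
    using assms by (simp add: n_subsets)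
  finally show ?thesis .
qed

text \<open>Factoring \<open>p ^ n\<close> out of each binomial weight leaves a power of the odds
  \<open>(1 - p) / p\<close>; this converts the bound \<open>1 / D\<close> into the claimed
  quotient.\<close>

lemma prob_binomial_atMost:
  fixes p :: real
  assumes p: "0 < p" "p \<le> 1" and m: "m \<le> n"
  shows "measure_pmf.prob (binomial_pmf n (1 - p)) {..m} =
    p ^ n * (\<Sum>j\<le>m. real (n choose j) * ((1 - p) / p) ^ j)"
proof -
  have "measure_pmf.prob (binomial_pmf n (1 - p)) {..m} =
      (\<Sum>j\<le>m. pmf (binomial_pmf n (1 - p)) j)"
    by (simp add: measure_measure_pmf_finite)
  also have "\<dots> = (\<Sum>j\<le>m. p ^ n * (real (n choose j) * ((1 - p) / p) ^ j))"
  proof (intro sum.cong refl)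
    fix j assume "j \<in> {..m}"
    \<comment> \<open>Here \<open>m \<le> n\<close> keeps the subtraction \<open>n - j\<close> from
      truncating.\<close>
    then have "p ^ n = p ^ j * p ^ (n - j)"
      using m by (simp flip: power_add)
    then show "pmf (binomial_pmf n (1 - p)) j = p ^ n * (real (n choose j) * ((1 - p) / p) ^ j)"
      using p by (simp add: power_divide)
  qed
  finally show ?thesis by (simp add: sum_distrib_left)
qed

lemma prob_all_ones_le:
  assumes p: "0 < p" "p \<le> 1" and Q: "Q \<in> kwise_dists n k p" and m: "2 * m \<le> k"
  shows "measure_pmf.prob Q {x. \<forall>i\<in>{1..n}. x i} \<le>
    1 / (\<Sum>j\<le>m. real (n choose j) * ((1 - p) / p) ^ j)"
proof -
  define F where "F = {A. A \<subseteq> {1..n} \<and> card A \<le> m}"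
  define D where "D = (\<Sum>j\<le>m. real (n choose j) * ((1 - p) / p) ^ j)"
  define G where "G x = (\<Sum>A\<in>F. bit_character p A x)" for x
  have "finite F" by (simp add: F_def)
  have D: "(\<Sum>A\<in>F. ((1 - p) / p) ^ card A) = D"
    unfolding F_def D_def by (subst sum_power_card_small_subsets) auto
  \<comment> \<open>The term at \<open>j = 0\<close> is 1 and the others are nonnegative, so
    \<open>D\<close> is positive and may be divided by.\<close>
  have "(\<Sum>j\<in>{0}. real (n choose j) * ((1 - p) / p) ^ j) \<le> D"
    unfolding D_def using p by (intro sum_mono2) auto
  then have "D > 0" by simp
  have G_ones: "G x = D" if x: "\<forall>i\<in>{1..n}. x i" for x
  proof -
    have "bit_character p A x = ((1 - p) / p) ^ card A" if "A \<in> F" for A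
    proof -
      have "centered_bit p (x i) = (1 - p) / p" if "i \<in> A" for i
        using x \<open>A \<in> F\<close> that by (auto simp: F_def centered_bit_def)
      then show ?thesis by (simp add: bit_character_def)
    qed
    then show ?thesis by (simp add: G_def flip: D)
  qed
  have "measure_pmf.expectation Q (\<lambda>x. (G x)\<^sup>2) =
      (\<Sum>A\<in>F. \<Sum>B\<in>F. measure_pmf.expectation Q (\<lambda>x. bit_character p A x * bit_character p B x))"
    by (simp add: G_def power2_eq_square sum_product integrable_kwise_dists[OF Q])
  \<comment> \<open>Two members of \<open>F\<close> have total size at most
    \<open>2 * m \<le> k\<close>, so only the diagonal survives.\<close>
  also have "\<dots> = (\<Sum>A\<in>F. \<Sum>B\<in>F. if A = B then ((1 - p) / p) ^ card A else 0)"
    using p m by (intro sum.cong refl bit_character_orthogonal[OF _ Q]) (auto simp: F_def)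
  also have "\<dots> = D"
    using \<open>finite F\<close> by (simp add: D)
  finally have EG: "measure_pmf.expectation Q (\<lambda>x. (G x)\<^sup>2) = D" .
  have "measure_pmf.prob Q {x. \<forall>i\<in>{1..n}. x i} * D\<^sup>2 =
      measure_pmf.expectation Q (\<lambda>x. indicator {x. \<forall>i\<in>{1..n}. x i} x * D\<^sup>2)"
    by simp
  \<comment> \<open>Pointwise, \<open>(G x)\<^sup>2\<close> equals \<open>D\<^sup>2\<close> on the
    all-ones event and is nonnegative elsewhere.\<close>
  also have "\<dots> \<le> measure_pmf.expectation Q (\<lambda>x. (G x)\<^sup>2)"
    by (intro integral_mono integrable_kwise_dists[OF Q]) (auto simp: G_ones split: split_indicator)
  finally have "measure_pmf.prob Q {x. \<forall>i\<in>{1..n}. x i} * D\<^sup>2 \<le> D"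
    by (simp add: EG)
  then show ?thesis
    unfolding D_def[symmetric] using \<open>D > 0\<close> by (simp add: field_simps power2_eq_square)
qed

theorem theorem23:
  fixes n k :: nat and p :: real
  assumes "n \<ge> 1" and "0 < p" and "p < 1" and "even k" and "k \<le> n"
  shows "max_all_ones n k p
           \<le> p ^ n / measure_pmf.prob (binomial_pmf n (1 - p)) {..k div 2}"
proof -
  obtain Q where Q: "Q \<in> kwise_dists n k p"
    and max: "max_all_ones n k p = measure_pmf.prob Q {x. \<forall>i\<in>{1..n}. x i}"
    using max_all_ones_attained(1)[of p n k] assms by auto
  have "max_all_ones n k p \<le> 1 / (\<Sum>j\<le>k div 2. real (n choose j) * ((1 - p) / p) ^ j)"
    unfolding max using assms by (intro prob_all_ones_le[OF _ _ Q]) auto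
  also have "\<dots> = p ^ n / measure_pmf.prob (binomial_pmf n (1 - p)) {..k div 2}"
    using assms by (subst prob_binomial_atMost) auto
  finally show ?thesis .
qed

end
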